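(* Let $R$ be a unital ring and let $E^\bullet$ be an $(n+1)$-complex of $R$-modules. Suppose that for any $a_1,a_2,\dots,a_n\in\mathbb Z$ the cochain complex $E^{a_1,a_2,\dots,a_n,*}$ with differential $d_{n+1}$ is exact. Then the truncated product totalisation ${}_{\mathrm{tr}}\mathrm{Tot}\,E^\bullet$ is acyclic.
   Context: An $(n+1)$-complex is a family of $R$-modules $E^{\mathbf b}$, $\mathbf b\in\mathbb Z^{n+1}$, with homomorphisms $d_i\colon E^{\mathbf b}\to E^{\mathbf b+\mathbf e_i}$ for $1\le i\le n+1$ ($\mathbf e_i$ the $i$th unit vector), satisfying $d_i\circ d_i=0$ and $d_id_j=-d_jd_i$ for $i<j$. Truncated product: for a $\mathbb Z^n$-indexed family of modules $M_{\mathbf a}$, ${}_{\mathrm{tr}}\prod_{\mathbf a\in\mathbb Z^n}M_{\mathbf a}$ is the submodule of $\prod_{\mathbf a}M_{\mathbf a}$ of those $g=(m_{\mathbf a})$ for which there is $k\in\mathbb Z$ (depending on $g$) such that $\min_{1\le i\le n}a_i\ge k$ whenever $m_{\mathbf a}\ne0$. The truncated product totalisation is the cochain complex with $({}_{\mathrm{tr}}\mathrm{Tot}\,E^\bullet)^k={}_{\mathrm{tr}}\prod_{\mathbf a\in\mathbb Z^n}E^{[\mathbf a,k]}$, where $[\mathbf a,k]=(a_1,\dots,a_n,k-a_1-\dots-a_n)$, and differential $d=d_1+d_2+\dots+d_{n+1}$; that is, $d(b)_{\mathbf a}=d_{n+1}(b_{\mathbf a})+\sum_{i=1}^nd_i(b_{\mathbf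 a-\mathbf e_i})$. *)

theory Defs
  imports "HOL-Algebra.Module" "HOL-Algebra.AbelCoset" "HOL-Library.FuncSet"
begin

text \<open>The locale \<^locale>\<open>module\<close> of the library insists on a commutative ring of scalars. The
  following locale has the same axioms over an arbitrary unital ring.\<close>

locale left_module = R?: ring R + M?: abelian_group M
  for R :: "('r, 'x) ring_scheme" (structure) and M :: "('r, 'm, 'y) module_scheme" (structure) +
  assumes smult_closed [simp, intro]:
      "\<lbrakk>r \<in> carrier R; x \<in> carrier M\<rbrakk> \<Longrightarrow> r \<odot>\<^bsub>M\<^esub> x \<in> carrier M"
    and smult_l_distr:
      "\<lbrakk>r \<in> carrier R; s \<in> carrier R; x \<in> carrier M\<rbrakk> \<Longrightarrow>
        (r \<oplus>\<^bsub>R\<^esub> s) \<odot>\<^bsub>M\<^esub> x = r \<odot>\<^bsub>M\<^esub> x \<oplus>\<^bsub>M\<^esub> s \<odot>\<^bsub>M\<^esub> x"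
    and smult_r_distr:
      "\<lbrakk>r \<in> carrier R; x \<in> carrier M; y \<in> carrier M\<rbrakk> \<Longrightarrow>
        r \<odot>\<^bsub>M\<^esub> (x \<oplus>\<^bsub>M\<^esub> y) = r \<odot>\<^bsub>M\<^esub> x \<oplus>\<^bsub>M\<^esub> r \<odot>\<^bsub>M\<^esub> y"
    and smult_assoc1:
      "\<lbrakk>r \<in> carrier R; s \<in> carrier R; x \<in> carrier M\<rbrakk> \<Longrightarrow>
        (r \<otimes>\<^bsub>R\<^esub> s) \<odot>\<^bsub>M\<^esub> x = r \<odot>\<^bsub>M\<^esub> (s \<odot>\<^bsub>M\<^esub> x)"
    and smult_one [simp]:
      "x \<in> carrier M \<Longrightarrow> \<one>\<^bsub>R\<^esub> \<odot>\<^bsub>M\<^esub> x = x"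

definition module_homs ::
    "('r, 'x) ring_scheme \<Rightarrow> ('r, 'm, 'y) module_scheme \<Rightarrow> ('r, 'k, 'z) module_scheme \<Rightarrow> ('m \<Rightarrow> 'k) set"
  where "module_homs R M N =
    {h \<in> carrier M \<rightarrow> carrier N.
      (\<forall>x\<in>carrier M. \<forall>y\<in>carrier M. h (x \<oplus>\<^bsub>M\<^esub> y) = h x \<oplus>\<^bsub>N\<^esub> h y) \<and>
      (\<forall>r\<in>carrier R. \<forall>x\<in>carrier M. h (r \<odot>\<^bsub>M\<^esub> x) = r \<odot>\<^bsub>N\<^esub> h x)}"

definition cochain_complex ::
    "('r, 'x) ring_scheme \<Rightarrow> (int \<Rightarrow> ('r, 'm, 'y) module_scheme) \<Rightarrow> (int \<Rightarrow> 'm \<Rightarrow> 'm) \<Rightarrow> bool"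
  where "cochain_complex R C \<delta> \<longleftrightarrow>
    (\<forall>k. left_module R (C k)) \<and>
    (\<forall>k. \<delta> k \<in> module_homs R (C k) (C (k + 1))) \<and>
    (\<forall>k. \<forall>x\<in>carrier (C k). \<delta> (k + 1) (\<delta> k x) = \<zero>\<^bsub>C (k + 2)\<^esub>)"

text \<open>A cochain complex is acyclic (equivalently: exact) if cocycles and coboundaries agree in
  every degree.\<close>

definition acyclic_complex ::
    "(int \<Rightarrow> ('r, 'm, 'y) module_scheme) \<Rightarrow> (int \<Rightarrow> 'm \<Rightarrow> 'm) \<Rightarrow> bool"
  where "acyclic_complex C \<delta> \<longleftrightarrow>
    (\<forall>k. a_kernel (C k) (C (k + 1)) (\<delta> k) = \<delta> (k - 1) ` carrier (C (k - 1)))"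

text \<open>Elements of \<open>\<int>\<^sup>N\<close> are functions on \<open>{1..N}\<close>, extended by \<^const>\<open>undefined\<close>. Thus
  \<open>b + e\<^sub>i\<close> is \<open>b(i := b i + 1)\<close>.\<close>

abbreviation int_tuples :: "nat \<Rightarrow> (nat \<Rightarrow> int) set"
  where "int_tuples N \<equiv> {1..N} \<rightarrow>\<^sub>E UNIV"

text \<open>An \<open>N\<close>-complex; \<open>d i b\<close> is the component \<open>E\<^sup>b \<rightarrow> E\<^bsup>b + e\<^sub>i\<^esup>\<close> of \<open>d\<^sub>i\<close>.\<close>

definition multicomplex ::
    "('r, 'x) ring_scheme \<Rightarrow> nat \<Rightarrow> ((nat \<Rightarrow> int) \<Rightarrow> ('r, 'm, 'y) module_scheme) \<Rightarrow>
     (nat \<Rightarrow> (nat \<Rightarrow> int) \<Rightarrow> 'm \<Rightarrow> 'm) \<Rightarrow> bool"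
  where "multicomplex R N E d \<longleftrightarrow>
    (\<forall>b\<in>int_tuples N. left_module R (E b)) \<and>
    (\<forall>i\<in>{1..N}. \<forall>b\<in>int_tuples N. d i b \<in> module_homs R (E b) (E (b(i := b i + 1)))) \<and>
    (\<forall>i\<in>{1..N}. \<forall>b\<in>int_tuples N. \<forall>x\<in>carrier (E b).
      d i (b(i := b i + 1)) (d i b x) = \<zero>\<^bsub>E (b(i := b i + 2))\<^esub>) \<and>
    (\<forall>i\<in>{1..N}. \<forall>j\<in>{1..N}. i < j \<longrightarrow> (\<forall>b\<in>int_tuples N. \<forall>x\<in>carrier (E b).
      d i (b(j := b j + 1)) (d j b x) =
        \<ominus>\<^bsub>E (b(i := b i + 1, j := b j + 1))\<^esub> d j (b(i := b i + 1)) (d i b x)))"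

text \<open>The ring multiplication and unit, which the record type \<^typ>\<open>('r, 'm) module\<close> inherits from
  rings, play no role for modules and are left unspecified. For \<open>n = 0\<close> the truncation condition
  is void.\<close>

definition truncated_product ::
    "nat \<Rightarrow> ((nat \<Rightarrow> int) \<Rightarrow> ('r, 'm, 'y) module_scheme) \<Rightarrow> ('r, (nat \<Rightarrow> int) \<Rightarrow> 'm) module"
  where "truncated_product n M =
    \<lparr>carrier = {g \<in> (\<Pi>\<^sub>E a\<in>int_tuples n. carrier (M a)).
        \<exists>k. \<forall>a\<in>int_tuples n. g a \<noteq> \<zero>\<^bsub>M a\<^esub> \<longrightarrow> (\<forall>i\<in>{1..n}. k \<le> a i)},
     mult = undefined,
     one = undefined,
     zero = (\<lambda>a\<in>int_tuples n. \<zero>\<^bsub>M a\<^esub>),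
     add = (\<lambda>g h. \<lambda>a\<in>int_tuples n. g a \<oplus>\<^bsub>M a\<^esub> h a),
     smult = (\<lambda>r g. \<lambda>a\<in>int_tuples n. r \<odot>\<^bsub>M a\<^esub> g a)\<rparr>"

text \<open>The tuple \<open>[a, k] = (a\<^sub>1, \<dots>, a\<^sub>n, k - a\<^sub>1 - \<dots> - a\<^sub>n)\<close>.\<close>

definition tot_index :: "nat \<Rightarrow> (nat \<Rightarrow> int) \<Rightarrow> int \<Rightarrow> (nat \<Rightarrow> int)"
  where "tot_index n a k = a(n + 1 := k - (\<Sum>i=1..n. a i))"

definition trTot ::
    "nat \<Rightarrow> ((nat \<Rightarrow> int) \<Rightarrow> ('r, 'm, 'y) module_scheme) \<Rightarrow> int \<Rightarrow> ('r, (nat \<Rightarrow> int) \<Rightarrow> 'm) module"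
  where "trTot n E k = truncated_product n (\<lambda>a. E (tot_index n a k))"

definition trTot_diff ::
    "nat \<Rightarrow> ((nat \<Rightarrow> int) \<Rightarrow> ('r, 'm, 'y) module_scheme) \<Rightarrow> (nat \<Rightarrow> (nat \<Rightarrow> int) \<Rightarrow> 'm \<Rightarrow> 'm) \<Rightarrow>
     int \<Rightarrow> ((nat \<Rightarrow> int) \<Rightarrow> 'm) \<Rightarrow> ((nat \<Rightarrow> int) \<Rightarrow> 'm)"
  where "trTot_diff n E d k g = (\<lambda>a\<in>int_tuples n.
    d (n + 1) (tot_index n a k) (g a) \<oplus>\<^bsub>E (tot_index n a (k + 1))\<^esub>
    (\<Oplus>\<^bsub>E (tot_index n a (k + 1))\<^esub>i\<in>{1..n}.
      d i (tot_index n (a(i := a i - 1)) k) (g (a(i := a i - 1)))))"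


text \<open>The truncated product is a module, and the truncated product totalisation is a cochain
  complex.\<close>

lemma module_homsD:
  assumes "h \<in> module_homs R M N"
  shows "x \<in> carrier M \<Longrightarrow> h x \<in> carrier N"
    and "\<lbrakk>x \<in> carrier M; y \<in> carrier M\<rbrakk> \<Longrightarrow> h (x \<oplus>\<^bsub>M\<^esub> y) = h x \<oplus>\<^bsub>N\<^esub> h y"
    and "\<lbrakk>r \<in> carrier R; x \<in> carrier M\<rbrakk> \<Longrightarrow> h (r \<odot>\<^bsub>M\<^esub> x) = r \<odot>\<^bsub>N\<^esub> h x"
  using assms by (auto simp: module_homs_def)

lemma module_homs_zero:
  assumes "h \<in> module_homs R M N" "left_module R M" "left_module R N"
  shows "h \<zero>\<^bsub>M\<^esub> = \<zero>\<^bsub>N\<^esub>"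
proof -
  interpret M: left_module R M by fact
  interpret N: left_module R N by fact
  have "h \<zero>\<^bsub>M\<^esub> \<oplus>\<^bsub>N\<^esub> h \<zero>\<^bsub>M\<^esub> = h \<zero>\<^bsub>M\<^esub>"
    using module_homsD(2)[OF assms(1), of "\<zero>\<^bsub>M\<^esub>" "\<zero>\<^bsub>M\<^esub>"] by simp
  then show ?thesis
    using module_homsD(1)[OF assms(1), of "\<zero>\<^bsub>M\<^esub>"] by (metis M.M.zero_closed N.M.add.l_cancel_one')
qed

lemma module_homs_finsum:
  assumes "h \<in> module_homs R M N" "left_module R M" "left_module R N"
    and "finite A" "f \<in> A \<rightarrow> carrier M"
  shows "h (finsum M f A) = finsum N (\<lambda>i. h (f i)) A"
proof -
  interpret M: left_module R M by fact
  interpret N: left_module R N by fact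
  show ?thesis
    using assms(4,5)
  proof (induction A rule: finite_induct)
    case empty
    then show ?case using module_homs_zero[OF assms(1-3)] by simp
  next
    case (insert x A)
    then have "(\<lambda>i. h (f i)) \<in> A \<rightarrow> carrier N" "h (f x) \<in> carrier N"
      using module_homsD(1)[OF assms(1)] by auto
    with insert show ?case
      by (simp add: module_homsD(2)[OF assms(1)])
  qed
qed

lemma (in left_module) smult_r_null [simp]:
  assumes "r \<in> carrier R"
  shows "r \<odot>\<^bsub>M\<^esub> \<zero>\<^bsub>M\<^esub> = \<zero>\<^bsub>M\<^esub>"
  by (metis assms M.add.l_cancel_one' M.r_zero M.zero_closed smult_closed smult_r_distr)

lemma (in left_module) smult_finsum:
  assumes "r \<in> carrier R" "finite A" "f \<in> A \<rightarrow> carrier M"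
  shows "r \<odot>\<^bsub>M\<^esub> finsum M f A = finsum M (\<lambda>i. r \<odot>\<^bsub>M\<^esub> f i) A"
  using assms(2,3)
proof (induction A rule: finite_induct)
  case (insert x A)
  then have "(\<lambda>i. r \<odot>\<^bsub>M\<^esub> f i) \<in> A \<rightarrow> carrier M" using assms(1) by auto
  with insert assms(1) show ?case by (simp add: smult_r_distr)
qed (simp add: assms(1))

lemma (in abelian_group) finsum_alternating:
  assumes "finite A"
    and "\<And>i j. \<lbrakk>i \<in> A; j \<in> A\<rbrakk> \<Longrightarrow> f i j \<in> carrier G"
    and "\<And>i. i \<in> A \<Longrightarrow> f i i = \<zero>"
    and "\<And>i j. \<lbrakk>i \<in> A; j \<in> A; i \<noteq> j\<rbrakk> \<Longrightarrow> f i j \<oplus> f j i = \<zero>"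
  shows "(\<Oplus>i\<in>A. \<Oplus>j\<in>A. f i j) = \<zero>"
  using assms
proof (induction A rule: finite_induct)
  case (insert x A)
  have c: "f x \<in> A \<rightarrow> carrier G" "(\<lambda>i. f i x) \<in> A \<rightarrow> carrier G"
    "(\<lambda>i. \<Oplus>j\<in>A. f i j) \<in> A \<rightarrow> carrier G" "f x x \<in> carrier G"
    using insert.prems(1) by (auto intro!: finsum_closed)
  have inner: "(\<Oplus>j\<in>insert x A. f i j) = f i x \<oplus> (\<Oplus>j\<in>A. f i j)" if "i \<in> insert x A" for i
    using that insert.prems(1) insert.hyps by (subst finsum_insert) auto
  have "(\<Oplus>i\<in>insert x A. \<Oplus>j\<in>insert x A. f i j)
      = (\<Oplus>i\<in>insert x A. f i x \<oplus> (\<Oplus>j\<in>A. f i j))"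
    using inner insert.prems(1) by (intro finsum_cong') (auto intro!: finsum_closed a_closed)
  also have "\<dots> = (f x x \<oplus> (\<Oplus>j\<in>A. f x j)) \<oplus> (\<Oplus>i\<in>A. f i x \<oplus> (\<Oplus>j\<in>A. f i j))"
    using c insert.hyps by (subst finsum_insert) (auto simp: Pi_def)
  also have "(\<Oplus>i\<in>A. f i x \<oplus> (\<Oplus>j\<in>A. f i j)) = (\<Oplus>i\<in>A. f i x)"
    using c insert.IH insert.prems by (subst finsum_addf) auto
  also have "(f x x \<oplus> (\<Oplus>j\<in>A. f x j)) \<oplus> (\<Oplus>i\<in>A. f i x) = (\<Oplus>j\<in>A. f x j \<oplus> f j x)"
    using c insert.prems(2)[of x] by (subst finsum_addf) auto
  also have "\<dots> = \<zero>"
    using insert.prems(3) insert.hyps by (intro add.finprod_one_eqI) auto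
  finally show ?case .
qed simp

lemma truncated_product_left_module:
  assumes "ring R" and M: "\<And>a. a \<in> int_tuples n \<Longrightarrow> left_module R (M a)"
  shows "left_module R (truncated_product n M)"
proof -
  let ?P = "truncated_product n M"
  have ab: "abelian_group (M a)" if "a \<in> int_tuples n" for a
    using M[OF that] by (simp add: left_module_def)
  have mon: "abelian_monoid (M a)" if "a \<in> int_tuples n" for a
    using ab[OF that] by (simp add: abelian_group_def)
  note [simp] = abelian_monoid.a_closed[OF mon] abelian_monoid.zero_closed[OF mon]
    abelian_monoid.l_zero[OF mon] abelian_monoid.r_zero[OF mon]
    left_module.smult_closed[OF M] left_module.smult_r_null[OF M] left_module.smult_one[OF M]
    abelian_group.a_inv_closed[OF ab] abelian_group.l_neg[OF ab]
  have carr: "g \<in> carrier ?P \<longleftrightarrow> g \<in> (\<Pi>\<^sub>E a\<in>int_tuples n. carrier (M a)) \<and>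
      (\<exists>k. \<forall>a\<in>int_tuples n. g a \<noteq> \<zero>\<^bsub>M a\<^esub> \<longrightarrow> (\<forall>i\<in>{1..n}. k \<le> a i))" for g
    by (simp add: truncated_product_def)
  have mem: "g a \<in> carrier (M a)" if "g \<in> carrier ?P" "a \<in> int_tuples n" for g a
    using that unfolding carr by (blast dest: PiE_mem)
  have ext: "g \<in> extensional (int_tuples n)" if "g \<in> carrier ?P" for g
    using that unfolding carr by (auto simp: PiE_def)
  have ops: "\<zero>\<^bsub>?P\<^esub> = (\<lambda>a\<in>int_tuples n. \<zero>\<^bsub>M a\<^esub>)"
    "g \<oplus>\<^bsub>?P\<^esub> h = (\<lambda>a\<in>int_tuples n. g a \<oplus>\<^bsub>M a\<^esub> h a)"
    "r \<odot>\<^bsub>?P\<^esub> g = (\<lambda>a\<in>int_tuples n. r \<odot>\<^bsub>M a\<^esub> g a)" for g h r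
    by (simp_all add: truncated_product_def)
  have cl: "(\<lambda>a\<in>int_tuples n. f a (g a)) \<in> carrier ?P"
    if g: "g \<in> carrier ?P"
      and f: "\<And>a x. \<lbrakk>a \<in> int_tuples n; x \<in> carrier (M a)\<rbrakk> \<Longrightarrow> f a x \<in> carrier (M a)"
      and z: "\<And>a. a \<in> int_tuples n \<Longrightarrow> f a \<zero>\<^bsub>M a\<^esub> = \<zero>\<^bsub>M a\<^esub>" for f g
  proof -
    obtain k where k: "\<And>a. \<lbrakk>a \<in> int_tuples n; g a \<noteq> \<zero>\<^bsub>M a\<^esub>\<rbrakk> \<Longrightarrow> \<forall>i\<in>{1..n}. k \<le> a i"
      using g unfolding carr by blast
    have "\<forall>i\<in>{1..n}. k \<le> a i" if "a \<in> int_tuples n" "f a (g a) \<noteq> \<zero>\<^bsub>M a\<^esub>" for a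
      using k[OF that(1)] z[OF that(1)] that(2) by metis
    moreover have "f a (g a) \<in> carrier (M a)" if "a \<in> int_tuples n" for a
      using f mem[OF g] that by blast
    ultimately show ?thesis
      unfolding carr by (intro conjI exI[of _ k]) auto
  qed
  have a_cl: "g \<oplus>\<^bsub>?P\<^esub> h \<in> carrier ?P" if g: "g \<in> carrier ?P" and h: "h \<in> carrier ?P" for g h
  proof -
    obtain k where k: "\<And>a. \<lbrakk>a \<in> int_tuples n; g a \<noteq> \<zero>\<^bsub>M a\<^esub>\<rbrakk> \<Longrightarrow> \<forall>i\<in>{1..n}. k \<le> a i"
      using g unfolding carr by blast
    obtain l where l: "\<And>a. \<lbrakk>a \<in> int_tuples n; h a \<noteq> \<zero>\<^bsub>M a\<^esub>\<rbrakk> \<Longrightarrow> \<forall>i\<in>{1..n}. l \<le> a i"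
      using h unfolding carr by blast
    have "\<forall>i\<in>{1..n}. min k l \<le> a i" if "a \<in> int_tuples n" "g a \<oplus>\<^bsub>M a\<^esub> h a \<noteq> \<zero>\<^bsub>M a\<^esub>" for a
    proof -
      have "g a \<noteq> \<zero>\<^bsub>M a\<^esub> \<or> h a \<noteq> \<zero>\<^bsub>M a\<^esub>"
        using that by auto
      then show ?thesis using k[OF that(1)] l[OF that(1)] by (auto simp: min_le_iff_disj)
    qed
    moreover have "g a \<oplus>\<^bsub>M a\<^esub> h a \<in> carrier (M a)" if "a \<in> int_tuples n" for a
      using mem[OF g that] mem[OF h that] that by simp
    ultimately show ?thesis
      unfolding carr ops by (intro conjI exI[of _ "min k l"]) auto
  qed
  have s_cl: "r \<odot>\<^bsub>?P\<^esub> g \<in> carrier ?P" if "r \<in> carrier R" "g \<in> carrier ?P" for r g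
    unfolding ops using that by (intro cl) auto
  have z_cl: "\<zero>\<^bsub>?P\<^esub> \<in> carrier ?P"
    unfolding carr ops by auto
  have eqI: "g = h" if "g \<in> carrier ?P" "h \<in> carrier ?P"
    "\<And>a. a \<in> int_tuples n \<Longrightarrow> g a = h a" for g h
    using ext[OF that(1)] ext[OF that(2)] that(3) by (rule extensionalityI)
  have app: "\<zero>\<^bsub>?P\<^esub> a = \<zero>\<^bsub>M a\<^esub>" "(g \<oplus>\<^bsub>?P\<^esub> h) a = g a \<oplus>\<^bsub>M a\<^esub> h a"
    "(r \<odot>\<^bsub>?P\<^esub> g) a = r \<odot>\<^bsub>M a\<^esub> g a" if "a \<in> int_tuples n" for g h r a
    using that by (simp_all add: ops)
  interpret R: ring R by fact
  have "abelian_group ?P"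
  proof (rule abelian_groupI)
    fix g assume g: "g \<in> carrier ?P"
    let ?h = "\<lambda>a\<in>int_tuples n. \<ominus>\<^bsub>M a\<^esub> g a"
    have h: "?h \<in> carrier ?P"
      using g by (intro cl) (auto simp: abelian_group.a_inv_closed[OF ab] abelian_group.minus_equality[OF ab])
    moreover have "?h \<oplus>\<^bsub>?P\<^esub> g = \<zero>\<^bsub>?P\<^esub>"
      using a_cl[OF h g] z_cl by (rule eqI) (simp add: app mem[OF g])
    ultimately show "\<exists>h\<in>carrier ?P. h \<oplus>\<^bsub>?P\<^esub> g = \<zero>\<^bsub>?P\<^esub>" by blast
    show "\<zero>\<^bsub>?P\<^esub> \<oplus>\<^bsub>?P\<^esub> g = g"
      using a_cl[OF z_cl g] g by (rule eqI) (simp add: app mem[OF g])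
  next
    fix f g h assume f: "f \<in> carrier ?P" and g: "g \<in> carrier ?P" and h: "h \<in> carrier ?P"
    show "f \<oplus>\<^bsub>?P\<^esub> g \<oplus>\<^bsub>?P\<^esub> h = f \<oplus>\<^bsub>?P\<^esub> (g \<oplus>\<^bsub>?P\<^esub> h)"
      using a_cl[OF a_cl[OF f g] h] a_cl[OF f a_cl[OF g h]]
      by (rule eqI) (simp add: app mem[OF f] mem[OF g] mem[OF h] abelian_monoid.a_assoc[OF mon])
  next
    fix f g assume f: "f \<in> carrier ?P" and g: "g \<in> carrier ?P"
    show "f \<oplus>\<^bsub>?P\<^esub> g = g \<oplus>\<^bsub>?P\<^esub> f"
      using a_cl[OF f g] a_cl[OF g f]
      by (rule eqI) (simp add: app mem[OF f] mem[OF g] abelian_monoid.a_comm[OF mon])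
  qed (fact z_cl | fact a_cl)+
  then show ?thesis
  proof (intro left_module.intro left_module_axioms.intro)
    fix r s f g assume r: "r \<in> carrier R" and s: "s \<in> carrier R"
      and f: "f \<in> carrier ?P" and g: "g \<in> carrier ?P"
    show "(r \<oplus>\<^bsub>R\<^esub> s) \<odot>\<^bsub>?P\<^esub> f = r \<odot>\<^bsub>?P\<^esub> f \<oplus>\<^bsub>?P\<^esub> s \<odot>\<^bsub>?P\<^esub> f"
      by (rule eqI)
        (simp_all add: app mem[OF f] r s f s_cl a_cl left_module.smult_l_distr[OF M])
    show "(r \<otimes>\<^bsub>R\<^esub> s) \<odot>\<^bsub>?P\<^esub> f = r \<odot>\<^bsub>?P\<^esub> (s \<odot>\<^bsub>?P\<^esub> f)"
      by (rule eqI)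
        (simp_all add: app mem[OF f] r s f s_cl a_cl left_module.smult_assoc1[OF M])
  next
    fix r f g assume r: "r \<in> carrier R" and f: "f \<in> carrier ?P" and g: "g \<in> carrier ?P"
    show "r \<odot>\<^bsub>?P\<^esub> (f \<oplus>\<^bsub>?P\<^esub> g) = r \<odot>\<^bsub>?P\<^esub> f \<oplus>\<^bsub>?P\<^esub> r \<odot>\<^bsub>?P\<^esub> g"
      by (rule eqI)
        (simp_all add: app mem[OF f] mem[OF g] r f g s_cl a_cl left_module.smult_r_distr[OF M])
  next
    fix f assume f: "f \<in> carrier ?P"
    show "\<one>\<^bsub>R\<^esub> \<odot>\<^bsub>?P\<^esub> f = f"
      by (rule eqI) (simp_all add: app mem[OF f] f s_cl)
  qed (simp_all add: assms(1) s_cl)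
qed

lemma tot_index_in [simplified, simp]:
  "a \<in> int_tuples n \<Longrightarrow> tot_index n a k \<in> int_tuples (n + 1)"
  by (auto simp: tot_index_def PiE_def extensional_def)

lemma fun_upd_int_tuples [simplified, simp]:
  "\<lbrakk>a \<in> int_tuples n; i \<in> {1..n}\<rbrakk> \<Longrightarrow> a(i := v) \<in> int_tuples n"
  by (auto simp: PiE_def extensional_def)

lemma tot_index_last:
  "(tot_index n a k)(n + 1 := tot_index n a k (n + 1) + 1) = tot_index n a (k + 1)"
  by (simp add: tot_index_def algebra_simps)

lemma tot_index_step:
  assumes "i \<in> {1..n}"
  shows "(tot_index n (a(i := a i - 1)) k)(i := tot_index n (a(i := a i - 1)) k i + 1)
    = tot_index n a (k + 1)"
proof -
  have "(\<Sum>j=1..n. (a(i := a i - 1)) j) = (\<Sum>j\<in>{1..n} - {i}. a j) + (a i - 1)"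
    using assms by (subst sum.remove[of _ i]) auto
  moreover have "(\<Sum>j=1..n. a j) = (\<Sum>j\<in>{1..n} - {i}. a j) + a i"
    using assms by (subst sum.remove[of _ i]) auto
  ultimately show ?thesis
    using assms by (auto simp: tot_index_def fun_eq_iff)
qed

lemma multicomplexD:
  assumes "multicomplex R N E d"
  shows "b \<in> int_tuples N \<Longrightarrow> left_module R (E b)"
    and "\<lbrakk>i \<in> {1..N}; b \<in> int_tuples N\<rbrakk> \<Longrightarrow> d i b \<in> module_homs R (E b) (E (b(i := b i + 1)))"
    and "\<lbrakk>i \<in> {1..N}; b \<in> int_tuples N; x \<in> carrier (E b)\<rbrakk> \<Longrightarrow>
      d i (b(i := b i + 1)) (d i b x) = \<zero>\<^bsub>E (b(i := b i + 2))\<^esub>"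
    and "\<lbrakk>i \<in> {1..N}; j \<in> {1..N}; i < j; b \<in> int_tuples N; x \<in> carrier (E b)\<rbrakk> \<Longrightarrow>
      d i (b(j := b j + 1)) (d j b x) =
        \<ominus>\<^bsub>E (b(i := b i + 1, j := b j + 1))\<^esub> d j (b(i := b i + 1)) (d i b x)"
  using assms unfolding multicomplex_def by blast+

lemma trTot_cochain_complex:
  assumes R: "ring R" and E: "multicomplex R (n + 1) E d"
  shows "cochain_complex R (trTot n E) (trTot_diff n E d)"
proof -
  let ?X = "\<lambda>a k. E (tot_index n a k)"
  let ?D = "trTot_diff n E d"
  have mod: "left_module R (?X a k)" if "a \<in> int_tuples n" for a k
    using multicomplexD(1)[OF E] that by simp
  have ab: "abelian_group (?X a k)" if "a \<in> int_tuples n" for a k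
    using mod[OF that] by (simp add: left_module_def)
  have mon: "abelian_monoid (?X a k)" if "a \<in> int_tuples n" for a k
    using ab[OF that] by (simp add: abelian_group_def)
  have h0: "d (n + 1) (tot_index n a k) \<in> module_homs R (?X a k) (?X a (k + 1))"
    if "a \<in> int_tuples n" for a k
    using multicomplexD(2)[OF E, of "n + 1" "tot_index n a k"] that
    unfolding tot_index_last by simp
  have hi: "d i (tot_index n (a(i := a i - 1)) k)
      \<in> module_homs R (?X (a(i := a i - 1)) k) (?X a (k + 1))"
    if "a \<in> int_tuples n" "i \<in> {1..n}" for a i k
    using multicomplexD(2)[OF E, of i "tot_index n (a(i := a i - 1)) k"] that
    unfolding tot_index_step[OF that(2)] by simp
  have Tmod: "left_module R (trTot n E k)" for k
    unfolding trTot_def using R mod by (rule truncated_product_left_module)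
  have carr: "g \<in> carrier (trTot n E k) \<longleftrightarrow> g \<in> (\<Pi>\<^sub>E a\<in>int_tuples n. carrier (?X a k)) \<and>
      (\<exists>l. \<forall>a\<in>int_tuples n. g a \<noteq> \<zero>\<^bsub>?X a k\<^esub> \<longrightarrow> (\<forall>i\<in>{1..n}. l \<le> a i))" for g k
    by (simp add: trTot_def truncated_product_def)
  have mem: "g a \<in> carrier (?X a k)" if "g \<in> carrier (trTot n E k)" "a \<in> int_tuples n" for g a k
    using that unfolding carr by (blast dest: PiE_mem)
  have Tapp: "\<zero>\<^bsub>trTot n E k\<^esub> = (\<lambda>a\<in>int_tuples n. \<zero>\<^bsub>?X a k\<^esub>)"
    "g \<oplus>\<^bsub>trTot n E k\<^esub> h = (\<lambda>a\<in>int_tuples n. g a \<oplus>\<^bsub>?X a k\<^esub> h a)"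
    "r \<odot>\<^bsub>trTot n E k\<^esub> g = (\<lambda>a\<in>int_tuples n. r \<odot>\<^bsub>?X a k\<^esub> g a)" for g h r k
    by (simp_all add: trTot_def truncated_product_def)
  let ?u = "\<lambda>k g a. d (n + 1) (tot_index n a k) (g a)"
  let ?t = "\<lambda>k g a i. d i (tot_index n (a(i := a i - 1)) k) (g (a(i := a i - 1)))"
  have D: "?D k g a = ?u k g a \<oplus>\<^bsub>?X a (k + 1)\<^esub> finsum (?X a (k + 1)) (?t k g a) {1..n}"
    if "a \<in> int_tuples n" for g a k
    using that by (simp add: trTot_diff_def)
  have t0: "?u k g a \<in> carrier (?X a (k + 1))"
    if "g \<in> carrier (trTot n E k)" "a \<in> int_tuples n" for g a k
    using module_homsD(1)[OF h0[OF that(2)] mem[OF that]] .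
  have t: "?t k g a i \<in> carrier (?X a (k + 1))"
    if "g \<in> carrier (trTot n E k)" "a \<in> int_tuples n" "i \<in> {1..n}" for g a k i
    using module_homsD(1)[OF hi[OF that(2,3)] mem[OF that(1)]] that(2,3) by simp
  have ts: "?t k g a \<in> {1..n} \<rightarrow> carrier (?X a (k + 1))"
    if "g \<in> carrier (trTot n E k)" "a \<in> int_tuples n" for g a k
    using t[OF that] by blast
  have tsum: "finsum (?X a (k + 1)) (?t k g a) {1..n} \<in> carrier (?X a (k + 1))"
    if "g \<in> carrier (trTot n E k)" "a \<in> int_tuples n" for g a k
    using ts[OF that] by (rule abelian_monoid.finsum_closed[OF mon[OF that(2)]])
  have Dext: "?D k g \<in> extensional (int_tuples n)" for k g
    by (simp add: trTot_diff_def)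
  have Dcl: "?D k g \<in> carrier (trTot n E (k + 1))" if g: "g \<in> carrier (trTot n E k)" for k g
  proof -
    obtain l where l: "\<And>a. \<lbrakk>a \<in> int_tuples n; g a \<noteq> \<zero>\<^bsub>?X a k\<^esub>\<rbrakk> \<Longrightarrow> \<forall>i\<in>{1..n}. l \<le> a i"
      using g unfolding carr by blast
    have "?D k g a = \<zero>\<^bsub>?X a (k + 1)\<^esub>"
      if a: "a \<in> int_tuples n" and na: "\<not> (\<forall>i\<in>{1..n}. l \<le> a i)" for a
    proof -
      have "?u k g a = \<zero>\<^bsub>?X a (k + 1)\<^esub>"
        using l[OF a] na module_homs_zero[OF h0 mod mod, OF a a a] by metis
      moreover have "?t k g a i = \<zero>\<^bsub>?X a (k + 1)\<^esub>" if i: "i \<in> {1..n}" for i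
      proof -
        have a': "a(i := a i - 1) \<in> int_tuples n" using a i by simp
        have "\<not> (\<forall>j\<in>{1..n}. l \<le> (a(i := a i - 1)) j)"
        proof -
          obtain j where j: "j \<in> {1..n}" "a j < l" using na by (auto simp: not_le)
          then have "(a(i := a i - 1)) j < l" by (cases "j = i") auto
          with j(1) show ?thesis by (meson not_le)
        qed
        then have "g (a(i := a i - 1)) = \<zero>\<^bsub>?X (a(i := a i - 1)) k\<^esub>"
          using l[OF a'] by metis
        then show ?thesis using module_homs_zero[OF hi mod mod, OF a i a' a] by simp
      qed
      then have "finsum (?X a (k + 1)) (?t k g a) {1..n} = \<zero>\<^bsub>?X a (k + 1)\<^esub>"
        by (intro comm_monoid.finprod_one_eqI[OF abelian_monoid.a_comm_monoid[OF mon[OF a]],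
              simplified, folded finsum_def]) auto
      ultimately show ?thesis
        using a by (simp only: D abelian_monoid.l_zero[OF mon] abelian_monoid.zero_closed[OF mon])
    qed
    moreover have "?D k g a \<in> carrier (?X a (k + 1))" if "a \<in> int_tuples n" for a
      unfolding D[OF that] using t0[OF g that] tsum[OF g that]
      by (rule abelian_monoid.a_closed[OF mon[OF that]])
    ultimately show ?thesis
      unfolding carr using Dext[of k g] by (intro conjI exI[of _ l]) (blast intro: PiE_I dest: extensional_arb)+
  qed
  have Dhom: "?D k \<in> module_homs R (trTot n E k) (trTot n E (k + 1))" for k
  proof -
    interpret T: left_module R "trTot n E k" by (rule Tmod)
    have "?D k (g \<oplus>\<^bsub>trTot n E k\<^esub> h) = ?D k g \<oplus>\<^bsub>trTot n E (k + 1)\<^esub> ?D k h"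
      if g: "g \<in> carrier (trTot n E k)" and h: "h \<in> carrier (trTot n E k)" for g h
    proof (rule extensionalityI[OF Dext])
      fix a assume a: "a \<in> int_tuples n"
      interpret X: left_module R "?X a (k + 1)" using a by (rule mod)
      have 0: "?u k (g \<oplus>\<^bsub>trTot n E k\<^esub> h) a = ?u k g a \<oplus>\<^bsub>?X a (k + 1)\<^esub> ?u k h a"
        using a module_homsD(2)[OF h0[OF a] mem[OF g a] mem[OF h a]] by (simp add: Tapp)
      have "finsum (?X a (k + 1)) (?t k (g \<oplus>\<^bsub>trTot n E k\<^esub> h) a) {1..n}
          = finsum (?X a (k + 1)) (\<lambda>i. ?t k g a i \<oplus>\<^bsub>?X a (k + 1)\<^esub> ?t k h a i) {1..n}"
      proof (rule X.finsum_cong')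
        fix i assume i: "i \<in> {1..n}"
        have a': "a(i := a i - 1) \<in> int_tuples n" using a i by simp
        show "?t k (g \<oplus>\<^bsub>trTot n E k\<^esub> h) a i = ?t k g a i \<oplus>\<^bsub>?X a (k + 1)\<^esub> ?t k h a i"
          using a' module_homsD(2)[OF hi[OF a i] mem[OF g a'] mem[OF h a']] by (simp add: Tapp)
      qed (use t[OF g a] t[OF h a] in auto)
      also have "\<dots> = finsum (?X a (k + 1)) (?t k g a) {1..n} \<oplus>\<^bsub>?X a (k + 1)\<^esub>
          finsum (?X a (k + 1)) (?t k h a) {1..n}"
        using ts[OF g a] ts[OF h a] by (rule X.finsum_addf)
      finally show "?D k (g \<oplus>\<^bsub>trTot n E k\<^esub> h) a = (?D k g \<oplus>\<^bsub>trTot n E (k + 1)\<^esub> ?D k h) a"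
        using a 0 t0[OF g a] t0[OF h a] tsum[OF g a] tsum[OF h a]
        by (simp only: D Tapp restrict_apply' X.a_ac X.a_closed)
    qed (simp add: Tapp)
    moreover have "?D k (r \<odot>\<^bsub>trTot n E k\<^esub> g) = r \<odot>\<^bsub>trTot n E (k + 1)\<^esub> ?D k g"
      if r: "r \<in> carrier R" and g: "g \<in> carrier (trTot n E k)" for r g
    proof (rule extensionalityI[OF Dext])
      fix a assume a: "a \<in> int_tuples n"
      interpret X: left_module R "?X a (k + 1)" using a by (rule mod)
      have 0: "?u k (r \<odot>\<^bsub>trTot n E k\<^esub> g) a = r \<odot>\<^bsub>?X a (k + 1)\<^esub> ?u k g a"
        using a module_homsD(3)[OF h0[OF a] r mem[OF g a]] by (simp add: Tapp)
      have "finsum (?X a (k + 1)) (?t k (r \<odot>\<^bsub>trTot n E k\<^esub> g) a) {1..n}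
          = finsum (?X a (k + 1)) (\<lambda>i. r \<odot>\<^bsub>?X a (k + 1)\<^esub> ?t k g a i) {1..n}"
      proof (rule X.finsum_cong')
        fix i assume i: "i \<in> {1..n}"
        have a': "a(i := a i - 1) \<in> int_tuples n" using a i by simp
        show "?t k (r \<odot>\<^bsub>trTot n E k\<^esub> g) a i = r \<odot>\<^bsub>?X a (k + 1)\<^esub> ?t k g a i"
          using a' module_homsD(3)[OF hi[OF a i] r mem[OF g a']] by (simp add: Tapp)
      qed (use t[OF g a] r in auto)
      also have "\<dots> = r \<odot>\<^bsub>?X a (k + 1)\<^esub> finsum (?X a (k + 1)) (?t k g a) {1..n}"
        using X.smult_finsum[OF r _ ts[OF g a]] by simp
      finally show "?D k (r \<odot>\<^bsub>trTot n E k\<^esub> g) a = (r \<odot>\<^bsub>trTot n E (k + 1)\<^esub> ?D k g) a"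
        using a 0 by (simp only: D Tapp restrict_apply' X.smult_r_distr[OF r t0[OF g a] tsum[OF g a]])
    qed (simp add: Tapp)
    ultimately show ?thesis
      using Dcl by (auto simp: module_homs_def)
  qed
  have DD: "?D (k + 1) (?D k g) = \<zero>\<^bsub>trTot n E (k + 1 + 1)\<^esub>"
    if g: "g \<in> carrier (trTot n E k)" for k g
  proof (rule extensionalityI[OF Dext])
    fix a assume a: "a \<in> int_tuples n"
    let ?Y = "?X a (k + 1 + 1)"
    interpret Y: left_module R ?Y using a by (rule mod)
    let ?F = "\<lambda>i j. d i (tot_index n (a(i := a i - 1)) (k + 1)) (?t k g (a(i := a i - 1)) j)"
    let ?G = "\<lambda>i. d i (tot_index n (a(i := a i - 1)) (k + 1)) (?u k g (a(i := a i - 1)))"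
    let ?H = "\<lambda>i. d (n + 1) (tot_index n a (k + 1)) (?t k g a i)"
    have a1: "a(i := a i - 1) \<in> int_tuples n" if "i \<in> {1..n}" for i
      using a that by simp
    have F: "?F i j \<in> carrier ?Y" if "i \<in> {1..n}" "j \<in> {1..n}" for i j
      by (rule module_homsD(1)[OF hi[OF a that(1)] t[OF g a1[OF that(1)] that(2)]])
    have G: "?G i \<in> carrier ?Y" if "i \<in> {1..n}" for i
      by (rule module_homsD(1)[OF hi[OF a that] t0[OF g a1[OF that]]])
    have H: "?H i \<in> carrier ?Y" if "i \<in> {1..n}" for i
      by (rule module_homsD(1)[OF h0[OF a] t[OF g a that]])
    have "(tot_index n a k)(n + 1 := tot_index n a k (n + 1) + 2) = tot_index n a (k + 1 + 1)"
      by (simp add: tot_index_def algebra_simps)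
    then have "d (n + 1) (tot_index n a (k + 1)) (?u k g a) = \<zero>\<^bsub>?Y\<^esub>"
      using multicomplexD(3)[OF E, of "n + 1" "tot_index n a k" "g a"] mem[OF g a] a
      unfolding tot_index_last by simp
    moreover have "?u (k + 1) (?D k g) a
        = d (n + 1) (tot_index n a (k + 1)) (?u k g a) \<oplus>\<^bsub>?Y\<^esub> finsum ?Y ?H {1..n}"
      unfolding D[OF a]
      by (subst module_homsD(2)[OF h0[OF a] t0[OF g a] tsum[OF g a]])
        (subst module_homs_finsum[OF h0[OF a] mod[OF a] mod[OF a] _ ts[OF g a]],
          rule finite_atLeastAtMost, rule refl)
    moreover have "finsum ?Y ?H {1..n} \<in> carrier ?Y"
      using H by (intro Y.finsum_closed) blast
    ultimately have 0: "?u (k + 1) (?D k g) a = finsum ?Y ?H {1..n}"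
      by (simp only: Y.l_zero)
    have 1: "?t (k + 1) (?D k g) a i = ?G i \<oplus>\<^bsub>?Y\<^esub> finsum ?Y (?F i) {1..n}"
      if i: "i \<in> {1..n}" for i
      unfolding D[OF a1[OF i]]
      by (subst module_homsD(2)[OF hi[OF a i] t0[OF g a1[OF i]] tsum[OF g a1[OF i]]])
        (subst module_homs_finsum[OF hi[OF a i] mod[OF a1[OF i]] mod[OF a] _ ts[OF g a1[OF i]]],
          rule finite_atLeastAtMost, rule refl)
    have GH: "?H i \<oplus>\<^bsub>?Y\<^esub> ?G i = \<zero>\<^bsub>?Y\<^esub>" if i: "i \<in> {1..n}" for i
    proof -
      let ?b = "tot_index n (a(i := a i - 1)) k"
      have b1: "?b(n + 1 := ?b (n + 1) + 1) = tot_index n (a(i := a i - 1)) (k + 1)"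
        by (rule tot_index_last)
      have b2: "?b(i := ?b i + 1) = tot_index n a (k + 1)"
        using i by (rule tot_index_step)
      have b3: "?b(i := ?b i + 1, n + 1 := ?b (n + 1) + 1) = tot_index n a (k + 1 + 1)"
        using tot_index_last[of n a "k + 1"] i unfolding b2[symmetric] by simp
      have "?G i = \<ominus>\<^bsub>?Y\<^esub> ?H i"
        using multicomplexD(4)[OF E, of i "n + 1" ?b "g (a(i := a i - 1))"] i a1[OF i] mem[OF g a1[OF i]]
        unfolding b3 unfolding b1 b2 by simp
      then show ?thesis using H[OF i] by (simp only: Y.r_neg)
    qed
    have Fij: "?F i j = \<ominus>\<^bsub>?Y\<^esub> ?F j i" if ij: "i \<in> {1..n}" "j \<in> {1..n}" "i < j" for i j
    proof -
      let ?c = "a(i := a i - 1, j := a j - 1)"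
      let ?b = "tot_index n ?c k"
      have c: "?c \<in> int_tuples n" using a ij by simp
      have tw: "a(j := a j - 1, i := a i - 1) = ?c" using ij by (auto simp: fun_eq_iff)
      have b1: "?b(j := ?b j + 1) = tot_index n (a(i := a i - 1)) (k + 1)"
        using tot_index_step[OF ij(2), of "a(i := a i - 1)" k] ij by simp
      have b2: "?b(i := ?b i + 1) = tot_index n (a(j := a j - 1)) (k + 1)"
        using tot_index_step[OF ij(1), of "a(j := a j - 1)" k] ij tw by simp
      have b3: "?b(i := ?b i + 1, j := ?b j + 1) = tot_index n a (k + 1 + 1)"
        using tot_index_step[OF ij(2), of a "k + 1"] ij unfolding b2[symmetric] by simp
      show ?thesis
        using multicomplexD(4)[OF E, of i j ?b "g ?c"] ij c mem[OF g c]
        unfolding b3 unfolding b1 b2 by (simp add: tw)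
    qed
    have Fii: "?F i i = \<zero>\<^bsub>?Y\<^esub>" if i: "i \<in> {1..n}" for i
    proof -
      let ?c = "a(i := a i - 1 - 1)"
      let ?b = "tot_index n ?c k"
      have c: "?c \<in> int_tuples n" using a i by simp
      have b1: "?b(i := ?b i + 1) = tot_index n (a(i := a i - 1)) (k + 1)"
        using tot_index_step[OF i, of "a(i := a i - 1)" k] by simp
      have "?b(i := ?b i + 2) = (?b(i := ?b i + 1))(i := (?b(i := ?b i + 1)) i + 1)" by (simp add: add.commute)
      also have "\<dots> = tot_index n a (k + 1 + 1)"
        unfolding b1 using i by (rule tot_index_step)
      finally have b2: "?b(i := ?b i + 2) = tot_index n a (k + 1 + 1)" .
      show ?thesis
        using multicomplexD(3)[OF E, of i ?b "g ?c"] i c mem[OF g c]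
        unfolding b1 b2 by simp
    qed
    have FF: "finsum ?Y (\<lambda>i. finsum ?Y (?F i) {1..n}) {1..n} = \<zero>\<^bsub>?Y\<^esub>"
    proof (rule Y.finsum_alternating)
      fix i j assume ij: "i \<in> {1..n}" "j \<in> {1..n}" "i \<noteq> j"
      show "?F i j \<oplus>\<^bsub>?Y\<^esub> ?F j i = \<zero>\<^bsub>?Y\<^esub>"
      proof (cases "i < j")
        case True
        show ?thesis unfolding Fij[OF ij(1,2) True] using F[OF ij(2,1)] by (rule Y.l_neg)
      next
        case False
        then have "j < i" using ij by simp
        show ?thesis unfolding Fij[OF ij(2,1) \<open>j < i\<close>] using F[OF ij(1,2)] by (rule Y.r_neg)
      qed
    qed (use F Fii in auto)
    have Fs: "finsum ?Y (?F i) {1..n} \<in> carrier ?Y" if "i \<in> {1..n}" for i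
      using F[OF that] by (intro Y.finsum_closed) blast
    have "finsum ?Y (?t (k + 1) (?D k g) a) {1..n}
        = finsum ?Y (\<lambda>i. ?G i \<oplus>\<^bsub>?Y\<^esub> finsum ?Y (?F i) {1..n}) {1..n}"
      using 1 G Fs by (intro Y.finsum_cong' refl) blast+
    also have "\<dots> = finsum ?Y ?G {1..n} \<oplus>\<^bsub>?Y\<^esub> \<zero>\<^bsub>?Y\<^esub>"
      unfolding FF[symmetric] using G Fs by (intro Y.finsum_addf) blast+
    also have "\<dots> = finsum ?Y ?G {1..n}"
      using G by (intro Y.r_zero Y.finsum_closed) blast
    finally have 2: "finsum ?Y (?t (k + 1) (?D k g) a) {1..n} = finsum ?Y ?G {1..n}" .
    have "?D (k + 1) (?D k g) a = finsum ?Y ?H {1..n} \<oplus>\<^bsub>?Y\<^esub> finsum ?Y ?G {1..n}"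
      unfolding D[OF a, of "k + 1"] 0 2 ..
    also have "\<dots> = finsum ?Y (\<lambda>i. ?H i \<oplus>\<^bsub>?Y\<^esub> ?G i) {1..n}"
      using G H by (intro Y.finsum_addf[symmetric]) blast+
    also have "\<dots> = \<zero>\<^bsub>?Y\<^esub>"
      using GH by (intro Y.add.finprod_one_eqI) blast
    finally show "?D (k + 1) (?D k g) a = \<zero>\<^bsub>trTot n E (k + 1 + 1)\<^esub> a"
      using a by (simp add: Tapp)
  qed (simp add: Tapp)
  show ?thesis
    using Tmod Dhom DD by (simp add: cochain_complex_def add.commute)
qed

end

theory Submission
  imports Defs
begin

text \<open>A cocycle \<open>z\<close> whose support lies in \<open>{a. \<forall>i. l \<le> a\<^sub>i}\<close> vanishes at all \<open>a\<close> of weight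
  \<open>a\<^sub>1 + \<dots> + a\<^sub>n < n l\<close>. If a cocycle vanishes in all weights below \<open>p\<close>, then its components of weight
  \<open>p\<close> are \<open>d\<^sub>n\<^sub>+\<^sub>1\<close>-cocycles, so by exactness a cochain concentrated in weight \<open>p\<close> with the same lower
  bound on its support kills them without changing anything in lower weights. Iterating over
  \<open>p = n l, n l + 1, \<dots>\<close>, every component of the sum of these cochains is a finite sum, and the sum
  has coboundary \<open>z\<close>.\<close>

section \<open>Weight of an index tuple\<close>

abbreviation weight :: "nat \<Rightarrow> (nat \<Rightarrow> int) \<Rightarrow> int"
  where "weight n a \<equiv> \<Sum>i=1..n. a i"

lemma weight_fun_upd_minus_one:
  assumes "i \<in> {1..n}"
  shows "weight n (a(i := a i - 1)) = weight n a - 1"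
proof -
  have "weight n (a(i := a i - 1)) = (a i - 1) + (\<Sum>j\<in>{1..n} - {i}. a j)"
    using assms by (subst sum.remove[of _ i]) auto
  moreover have "weight n a = a i + (\<Sum>j\<in>{1..n} - {i}. a j)"
    using assms by (subst sum.remove[of _ i]) auto
  ultimately show ?thesis by simp
qed

section \<open>Components of truncated cochains and of the total differential\<close>

locale total_multicomplex =
  fixes R :: "('r, 'x) ring_scheme" and n :: nat
    and E :: "(nat \<Rightarrow> int) \<Rightarrow> ('r, 'm, 'y) module_scheme"
    and d :: "nat \<Rightarrow> (nat \<Rightarrow> int) \<Rightarrow> 'm \<Rightarrow> 'm"
  assumes ring: "ring R" and multicomplex: "multicomplex R (n + 1) E d"
begin

abbreviation X :: "(nat \<Rightarrow> int) \<Rightarrow> int \<Rightarrow> ('r, 'm, 'y) module_scheme"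
  where "X a k \<equiv> E (tot_index n a k)"

abbreviation T :: "int \<Rightarrow> ('r, (nat \<Rightarrow> int) \<Rightarrow> 'm) module"
  where "T \<equiv> trTot n E"

abbreviation D :: "int \<Rightarrow> ((nat \<Rightarrow> int) \<Rightarrow> 'm) \<Rightarrow> (nat \<Rightarrow> int) \<Rightarrow> 'm"
  where "D \<equiv> trTot_diff n E d"

text \<open>Membership in the truncated product only asserts that some lower bound exists. Naming
  the bound makes it possible to keep one \<open>l\<close> through infinitely many corrections; with
  bounds varying from stage to stage, the limit could fail to be truncated.\<close>

definition supp_ge :: "int \<Rightarrow> int \<Rightarrow> ((nat \<Rightarrow> int) \<Rightarrow> 'm) \<Rightarrow> bool"
  where "supp_ge l k g \<longleftrightarrow> (\<forall>a\<in>int_tuples n. g a \<noteq> \<zero>\<^bsub>X a k\<^esub> \<longrightarrow> (\<forall>i\<in>{1..n}. l \<le> a i))"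

lemma left_module_X: "a \<in> int_tuples n \<Longrightarrow> left_module R (X a k)"
  using multicomplexD(1)[OF multicomplex] by simp

lemma abelian_group_X: "a \<in> int_tuples n \<Longrightarrow> abelian_group (X a k)"
  using left_module_X by (simp add: left_module_def)

lemma left_module_T: "left_module R (T k)"
  and D_hom: "D k \<in> module_homs R (T k) (T (k + 1))"
  and D_D: "g \<in> carrier (T k) \<Longrightarrow> D (k + 1) (D k g) = \<zero>\<^bsub>T (k + 2)\<^esub>"
  using trTot_cochain_complex[OF ring multicomplex] by (auto simp: cochain_complex_def)

lemma D_closed: "g \<in> carrier (T k) \<Longrightarrow> D k g \<in> carrier (T (k + 1))"
  by (rule module_homsD(1)[OF D_hom])

lemma last_diff_hom:
  "a \<in> int_tuples n \<Longrightarrow> d (n + 1) (tot_index n a k) \<in> module_homs R (X a k) (X a (k + 1))"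
  using multicomplexD(2)[OF multicomplex, of "n + 1" "tot_index n a k"]
  unfolding tot_index_last by simp

lemma step_diff_hom:
  assumes "a \<in> int_tuples n" "i \<in> {1..n}"
  shows "d i (tot_index n (a(i := a i - 1)) k) \<in> module_homs R (X (a(i := a i - 1)) k) (X a (k + 1))"
  using multicomplexD(2)[OF multicomplex, of i "tot_index n (a(i := a i - 1)) k"] assms
  unfolding tot_index_step[OF assms(2)] by simp

lemma carrier_T_iff:
  "g \<in> carrier (T k) \<longleftrightarrow> g \<in> (\<Pi>\<^sub>E a\<in>int_tuples n. carrier (X a k)) \<and> (\<exists>l. supp_ge l k g)"
  by (simp add: trTot_def truncated_product_def supp_ge_def)

lemma T_component_closed:
  "\<lbrakk>g \<in> carrier (T k); a \<in> int_tuples n\<rbrakk> \<Longrightarrow> g a \<in> carrier (X a k)"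
  unfolding carrier_T_iff by (blast dest: PiE_mem)

lemma T_eqI:
  assumes "g \<in> carrier (T k)" "h \<in> carrier (T k)" "\<And>a. a \<in> int_tuples n \<Longrightarrow> g a = h a"
  shows "g = h"
proof (rule PiE_ext)
  show "g \<in> (\<Pi>\<^sub>E a\<in>int_tuples n. carrier (X a k))" "h \<in> (\<Pi>\<^sub>E a\<in>int_tuples n. carrier (X a k))"
    using assms(1,2) unfolding carrier_T_iff by simp_all
qed (rule assms(3))

lemma T_zero_apply: "a \<in> int_tuples n \<Longrightarrow> \<zero>\<^bsub>T k\<^esub> a = \<zero>\<^bsub>X a k\<^esub>"
  and T_add_apply: "a \<in> int_tuples n \<Longrightarrow> (g \<oplus>\<^bsub>T k\<^esub> h) a = g a \<oplus>\<^bsub>X a k\<^esub> h a"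
  by (simp_all add: trTot_def truncated_product_def)

text \<open>Subtraction is derived from the addition of the module and is not a field of the record,
  so its componentwise form does not come from unfolding. It follows from uniqueness of additive
  inverses in each component.\<close>

lemma T_minus_apply:
  assumes "g \<in> carrier (T k)" "h \<in> carrier (T k)" "a \<in> int_tuples n"
  shows "(g \<ominus>\<^bsub>T k\<^esub> h) a = g a \<ominus>\<^bsub>X a k\<^esub> h a"
proof -
  interpret T: left_module R "T k" by (rule left_module_T)
  interpret X: left_module R "X a k" using assms(3) by (rule left_module_X)
  have "(\<ominus>\<^bsub>T k\<^esub> h \<oplus>\<^bsub>T k\<^esub> h) a = \<zero>\<^bsub>X a k\<^esub>"
    using assms by (simp only: T.M.l_neg T_zero_apply)
  then have "(\<ominus>\<^bsub>T k\<^esub> h) a \<oplus>\<^bsub>X a k\<^esub> h a = \<zero>\<^bsub>X a k\<^esub>"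
    using assms(3) by (simp only: T_add_apply)
  then have "(\<ominus>\<^bsub>T k\<^esub> h) a = \<ominus>\<^bsub>X a k\<^esub> h a"
    using assms by (metis X.M.minus_equality T_component_closed T.M.a_inv_closed)
  then show ?thesis
    using assms(3) by (simp only: a_minus_def T_add_apply)
qed

text \<open>This is what lets the coboundary of the limit cochain be computed at a finite stage: the
  component of \<open>D k g\<close> at \<open>a\<close> involves \<open>g\<close> only at
  \<open>a\<close> and at its \<open>n\<close> predecessors.\<close>

lemma D_local:
  assumes "g \<in> carrier (T k)" "h \<in> carrier (T k)" "a \<in> int_tuples n" "g a = h a"
    and "\<And>i. i \<in> {1..n} \<Longrightarrow> g (a(i := a i - 1)) = h (a(i := a i - 1))"
  shows "D k g a = D k h a"
proof -
  interpret X: left_module R "X a (k + 1)" using assms(3) by (rule left_module_X)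
  have "(\<Oplus>\<^bsub>X a (k + 1)\<^esub>i\<in>{1..n}. d i (tot_index n (a(i := a i - 1)) k) (g (a(i := a i - 1))))
      = (\<Oplus>\<^bsub>X a (k + 1)\<^esub>i\<in>{1..n}. d i (tot_index n (a(i := a i - 1)) k) (h (a(i := a i - 1))))"
  proof (rule X.finsum_cong'[OF refl])
    show "(\<lambda>i. d i (tot_index n (a(i := a i - 1)) k) (h (a(i := a i - 1))))
        \<in> {1..n} \<rightarrow> carrier (X a (k + 1))"
    proof
      fix i assume i: "i \<in> {1..n}"
      then have "a(i := a i - 1) \<in> int_tuples n" using assms(3) by simp
      then show "d i (tot_index n (a(i := a i - 1)) k) (h (a(i := a i - 1))) \<in> carrier (X a (k + 1))"
        by (rule module_homsD(1)[OF step_diff_hom[OF assms(3) i] T_component_closed[OF assms(2)]])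
    qed
  qed (simp only: assms(5))
  then show ?thesis
    using assms(3,4) by (simp add: trTot_diff_def)
qed

text \<open>Each \<open>d i\<close> with \<open>i\<close> in \<open>{1..n}\<close> acts on the
  component at a predecessor of \<open>a\<close>, hence on zero. Only the column differential
  survives.\<close>

lemma D_leading_term:
  assumes g: "g \<in> carrier (T k)" and a: "a \<in> int_tuples n"
    and 0: "\<And>i. i \<in> {1..n} \<Longrightarrow> g (a(i := a i - 1)) = \<zero>\<^bsub>X (a(i := a i - 1)) k\<^esub>"
  shows "D k g a = d (n + 1) (tot_index n a k) (g a)"
proof -
  interpret X: left_module R "X a (k + 1)" using a by (rule left_module_X)
  have "d i (tot_index n (a(i := a i - 1)) k) (g (a(i := a i - 1))) = \<zero>\<^bsub>X a (k + 1)\<^esub>"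
    if "i \<in> {1..n}" for i
    unfolding 0[OF that] using that a
    by (intro module_homs_zero[OF step_diff_hom] left_module_X) auto
  then have "(\<Oplus>\<^bsub>X a (k + 1)\<^esub>i\<in>{1..n}. d i (tot_index n (a(i := a i - 1)) k) (g (a(i := a i - 1))))
      = \<zero>\<^bsub>X a (k + 1)\<^esub>"
    by (intro X.M.add.finprod_one_eqI) auto
  moreover have "d (n + 1) (tot_index n a k) (g a) \<in> carrier (X a (k + 1))"
    using T_component_closed[OF g a] by (rule module_homsD(1)[OF last_diff_hom[OF a]])
  ultimately show ?thesis
    using a by (simp add: trTot_diff_def)
qed

lemma D_vanishes:
  assumes g: "g \<in> carrier (T k)" and a: "a \<in> int_tuples n" and ga: "g a = \<zero>\<^bsub>X a k\<^esub>"
    and 0: "\<And>i. i \<in> {1..n} \<Longrightarrow> g (a(i := a i - 1)) = \<zero>\<^bsub>X (a(i := a i - 1)) k\<^esub>"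
  shows "D k g a = \<zero>\<^bsub>X a (k + 1)\<^esub>"
proof -
  have "D k g a = d (n + 1) (tot_index n a k) (g a)"
    using g a 0 by (rule D_leading_term)
  also have "\<dots> = \<zero>\<^bsub>X a (k + 1)\<^esub>"
    unfolding ga
    by (rule module_homs_zero[OF last_diff_hom[OF a] left_module_X[OF a] left_module_X[OF a]])
  finally show ?thesis .
qed

section \<open>Stability of support bounds\<close>

lemma supp_ge_D:
  assumes g: "g \<in> carrier (T k)" and l: "supp_ge l k g"
  shows "supp_ge l (k + 1) (D k g)"
  unfolding supp_ge_def
proof (intro ballI impI, rule ccontr)
  fix a j assume a: "a \<in> int_tuples n" and nz: "D k g a \<noteq> \<zero>\<^bsub>X a (k + 1)\<^esub>"
    and j: "j \<in> {1..n}" "\<not> l \<le> a j"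
  have "g a = \<zero>\<^bsub>X a k\<^esub>"
    using l a j unfolding supp_ge_def by blast
  moreover have "g (a(i := a i - 1)) = \<zero>\<^bsub>X (a(i := a i - 1)) k\<^esub>" if i: "i \<in> {1..n}" for i
  proof -
    \<comment> \<open>Passing to a predecessor never raises a coordinate, so a coordinate below
      \<open>l\<close> stays below \<open>l\<close>.\<close>
    have "\<not> l \<le> (a(i := a i - 1)) j" using j(2) by auto
    moreover have "a(i := a i - 1) \<in> int_tuples n" using a i by simp
    ultimately show ?thesis
      using l j(1) unfolding supp_ge_def by blast
  qed
  ultimately show False
    using D_vanishes[OF g a] nz by blast
qed

lemma supp_ge_add:
  assumes "supp_ge l k g" "supp_ge l k h"
  shows "supp_ge l k (g \<oplus>\<^bsub>T k\<^esub> h)"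
  unfolding supp_ge_def
proof (intro ballI impI)
  fix a i assume a: "a \<in> int_tuples n" and i: "i \<in> {1..n}"
    and nz: "(g \<oplus>\<^bsub>T k\<^esub> h) a \<noteq> \<zero>\<^bsub>X a k\<^esub>"
  interpret X: left_module R "X a k" using a by (rule left_module_X)
  have "g a \<noteq> \<zero>\<^bsub>X a k\<^esub> \<or> h a \<noteq> \<zero>\<^bsub>X a k\<^esub>"
    using nz unfolding T_add_apply[OF a] by auto
  then show "l \<le> a i"
    using assms a i unfolding supp_ge_def by blast
qed

lemma supp_ge_minus:
  assumes "g \<in> carrier (T k)" "h \<in> carrier (T k)" "supp_ge l k g" "supp_ge l k h"
  shows "supp_ge l k (g \<ominus>\<^bsub>T k\<^esub> h)"
  unfolding supp_ge_def
proof (intro ballI impI)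
  fix a i assume a: "a \<in> int_tuples n" and i: "i \<in> {1..n}"
    and nz: "(g \<ominus>\<^bsub>T k\<^esub> h) a \<noteq> \<zero>\<^bsub>X a k\<^esub>"
  interpret X: left_module R "X a k" using a by (rule left_module_X)
  have "g a \<noteq> \<zero>\<^bsub>X a k\<^esub> \<or> h a \<noteq> \<zero>\<^bsub>X a k\<^esub>"
    using nz unfolding T_minus_apply[OF assms(1,2) a] by (auto simp: X.M.minus_eq)
  then show "l \<le> a i"
    using assms a i unfolding supp_ge_def by blast
qed

end

section \<open>Exact columns and the correction of a primitive, one weight at a time\<close>

locale exact_total_multicomplex = total_multicomplex +
  assumes exact: "a \<in> int_tuples n \<Longrightarrow>
    acyclic_complex (\<lambda>m. E (a(n + 1 := m))) (\<lambda>m. d (n + 1) (a(n + 1 := m)))"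
begin

lemma last_diff_preimage:
  assumes a: "a \<in> int_tuples n" and x: "x \<in> carrier (X a (k + 1))"
    and dx: "d (n + 1) (tot_index n a (k + 1)) x = \<zero>\<^bsub>X a (k + 2)\<^esub>"
  obtains y where "y \<in> carrier (X a k)" "d (n + 1) (tot_index n a k) y = x"
proof -
  \<comment> \<open>The last coordinate of \<open>tot_index n a (k + 1)\<close>: exactness of the
    column over \<open>a\<close> in degree \<open>?m\<close> concerns total degree
    \<open>k + 1\<close>.\<close>
  let ?m = "k + 1 - weight n a"
  have eqs: "a(n + 1 := ?m) = tot_index n a (k + 1)" "a(n + 1 := ?m + 1) = tot_index n a (k + 2)"
    "a(n + 1 := ?m - 1) = tot_index n a k"
    by (simp_all add: tot_index_def algebra_simps)
  have "a_kernel (X a (k + 1)) (X a (k + 2)) (d (n + 1) (tot_index n a (k + 1)))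
      = d (n + 1) (tot_index n a k) ` carrier (X a k)"
    using exact[OF a] unfolding acyclic_complex_def eqs[symmetric] by blast
  moreover have "x \<in> a_kernel (X a (k + 1)) (X a (k + 2)) (d (n + 1) (tot_index n a (k + 1)))"
    using x dx by (simp add: a_kernel_def')
  ultimately have "x \<in> d (n + 1) (tot_index n a k) ` carrier (X a k)" by simp
  then show thesis using that by (elim imageE) simp
qed

text \<open>In weight \<open>p\<close> all predecessors have weight \<open>p - 1\<close>, where
  \<open>z\<close> vanishes, so the cocycle condition there says that \<open>z a\<close> is a
  cocycle of its column. Exactness supplies a preimage for each such component separately.\<close>

lemma cocycle_leading_term:
  assumes z: "z \<in> carrier (T (k + 1))" and Dz: "D (k + 1) z = \<zero>\<^bsub>T (k + 2)\<^esub>"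
    and l: "supp_ge l (k + 1) z"
    and low: "\<And>a. \<lbrakk>a \<in> int_tuples n; weight n a < p\<rbrakk> \<Longrightarrow> z a = \<zero>\<^bsub>X a (k + 1)\<^esub>"
  obtains c where "c \<in> carrier (T k)" "supp_ge l k c"
    "\<And>a. \<lbrakk>a \<in> int_tuples n; weight n a < p\<rbrakk> \<Longrightarrow> c a = \<zero>\<^bsub>X a k\<^esub>"
    "\<And>a. \<lbrakk>a \<in> int_tuples n; weight n a \<le> p\<rbrakk> \<Longrightarrow> D k c a = z a"
proof -
  have lower: "a(i := a i - 1) \<in> int_tuples n" "weight n (a(i := a i - 1)) < p"
    if "a \<in> int_tuples n" "weight n a \<le> p" "i \<in> {1..n}" for a i
    using that weight_fun_upd_minus_one[OF that(3), of a] by simp_all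
  have "\<exists>y. y \<in> carrier (X a k) \<and> d (n + 1) (tot_index n a k) y = z a"
    if a: "a \<in> int_tuples n" and w: "weight n a = p" for a
  proof -
    have "d (n + 1) (tot_index n a (k + 1)) (z a) = D (k + 1) z a"
      using low lower[OF a] w by (intro D_leading_term[OF z a, symmetric]) simp
    then have "d (n + 1) (tot_index n a (k + 1)) (z a) = \<zero>\<^bsub>X a (k + 2)\<^esub>"
      unfolding Dz T_zero_apply[OF a] .
    then show ?thesis
      using last_diff_preimage[OF a T_component_closed[OF z a]] by blast
  qed
  then obtain y where y: "\<And>a. \<lbrakk>a \<in> int_tuples n; weight n a = p\<rbrakk> \<Longrightarrow>
      y a \<in> carrier (X a k) \<and> d (n + 1) (tot_index n a k) (y a) = z a"
    by metis
  \<comment> \<open>A preimage of zero may be nonzero, so the chosen \<open>y a\<close> is used only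
    where \<open>z a\<close> is nonzero. The support of \<open>c\<close> then lies in that of
    \<open>z\<close> and inherits the bound \<open>l\<close>.\<close>
  define c where "c = (\<lambda>a\<in>int_tuples n.
    if weight n a = p \<and> z a \<noteq> \<zero>\<^bsub>X a (k + 1)\<^esub> then y a else \<zero>\<^bsub>X a k\<^esub>)"
  have zero_closed: "\<zero>\<^bsub>X a k\<^esub> \<in> carrier (X a k)" if "a \<in> int_tuples n" for a
    by (rule abelian_monoid.zero_closed[OF abelian_group.axioms(1)[OF abelian_group_X[OF that]]])
  have supp: "supp_ge l k c"
    using l unfolding supp_ge_def c_def by auto
  have c: "c \<in> carrier (T k)"
    unfolding carrier_T_iff using supp y zero_closed by (auto simp: c_def)
  have c_low: "c a = \<zero>\<^bsub>X a k\<^esub>" if "a \<in> int_tuples n" "weight n a < p" for a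
    using that by (simp add: c_def)
  have "D k c a = z a" if a: "a \<in> int_tuples n" and w: "weight n a \<le> p" for a
  proof -
    have "D k c a = d (n + 1) (tot_index n a k) (c a)"
      using c_low lower[OF a w] by (intro D_leading_term[OF c a]) blast
    also have "\<dots> = z a"
    proof (cases "weight n a = p \<and> z a \<noteq> \<zero>\<^bsub>X a (k + 1)\<^esub>")
      case True
      then show ?thesis using y[OF a] a by (simp add: c_def)
    next
      case False
      then have "z a = \<zero>\<^bsub>X a (k + 1)\<^esub>" using low[OF a] w by fastforce
      moreover have "c a = \<zero>\<^bsub>X a k\<^esub>" using a False by (auto simp: c_def)
      ultimately show ?thesis
        using module_homs_zero[OF last_diff_hom[OF a] left_module_X[OF a] left_module_X[OF a]] by metis
    qed
    finally show ?thesis .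
  qed
  then show thesis using that c supp c_low by blast
qed

text \<open>The error \<open>z - D k b\<close> is again a cocycle with support bound
  \<open>l\<close>, and it vanishes below weight \<open>p\<close>. Adding to \<open>b\<close> a
  cochain that kills its leading term gains one weight and leaves \<open>b\<close> unchanged in
  smaller weights.\<close>

lemma improve_primitive:
  assumes z: "z \<in> carrier (T (k + 1))" and Dz: "D (k + 1) z = \<zero>\<^bsub>T (k + 2)\<^esub>"
    and lz: "supp_ge l (k + 1) z"
    and b: "b \<in> carrier (T k)" and lb: "supp_ge l k b"
    and low: "\<And>a. \<lbrakk>a \<in> int_tuples n; weight n a < p\<rbrakk> \<Longrightarrow> D k b a = z a"
  obtains b' where "b' \<in> carrier (T k)" "supp_ge l k b'"
    "\<And>a. \<lbrakk>a \<in> int_tuples n; weight n a < p\<rbrakk> \<Longrightarrow> b' a = b a"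
    "\<And>a. \<lbrakk>a \<in> int_tuples n; weight n a < p + 1\<rbrakk> \<Longrightarrow> D k b' a = z a"
proof -
  interpret T0: left_module R "T k" by (rule left_module_T)
  interpret T1: left_module R "T (k + 1)" by (rule left_module_T)
  interpret T2: left_module R "T (k + 2)" by (rule left_module_T)
  let ?z = "z \<ominus>\<^bsub>T (k + 1)\<^esub> D k b"
  have Db: "D k b \<in> carrier (T (k + 1))" using b by (rule D_closed)
  have z': "?z \<in> carrier (T (k + 1))" using z Db by (rule T1.M.minus_closed)
  have hom: "D (k + 1) \<in> module_homs R (T (k + 1)) (T (k + 2))"
    using D_hom[of "k + 1"] by (simp add: add.assoc)
  \<comment> \<open>Additivity is applied to the sum of the error and \<open>D k b\<close>, which is
    \<open>z\<close>; both \<open>z\<close> and \<open>D k b\<close> are cocycles, so the error is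
    one too.\<close>
  have "D (k + 1) ?z \<oplus>\<^bsub>T (k + 2)\<^esub> D (k + 1) (D k b) = D (k + 1) (?z \<oplus>\<^bsub>T (k + 1)\<^esub> D k b)"
    using module_homsD(2)[OF hom z' Db] by simp
  also have "?z \<oplus>\<^bsub>T (k + 1)\<^esub> D k b = z"
    using z Db by (simp add: T1.M.minus_eq T1.M.a_assoc T1.M.l_neg)
  finally have Dz': "D (k + 1) ?z = \<zero>\<^bsub>T (k + 2)\<^esub>"
    using module_homsD(1)[OF hom z'] by (simp add: Dz D_D[OF b])
  have z'_low: "?z a = \<zero>\<^bsub>X a (k + 1)\<^esub>" if a: "a \<in> int_tuples n" and w: "weight n a < p" for a
  proof -
    interpret X: left_module R "X a (k + 1)" using a by (rule left_module_X)
    show ?thesis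
      unfolding T_minus_apply[OF z Db a] low[OF a w]
      using T_component_closed[OF z a] by (simp add: X.M.minus_eq X.M.r_neg)
  qed
  obtain c where c: "c \<in> carrier (T k)" "supp_ge l k c"
    and c_low: "\<And>a. \<lbrakk>a \<in> int_tuples n; weight n a < p\<rbrakk> \<Longrightarrow> c a = \<zero>\<^bsub>X a k\<^esub>"
    and Dc: "\<And>a. \<lbrakk>a \<in> int_tuples n; weight n a \<le> p\<rbrakk> \<Longrightarrow> D k c a = ?z a"
    by (rule cocycle_leading_term[OF z' Dz' supp_ge_minus[OF z Db lz supp_ge_D[OF b lb]] z'_low])
      (blast intro: that)+
  show thesis
  proof
    show "b \<oplus>\<^bsub>T k\<^esub> c \<in> carrier (T k)" using b c(1) by (rule T0.M.a_closed)
    show "supp_ge l k (b \<oplus>\<^bsub>T k\<^esub> c)" using lb c(2) by (rule supp_ge_add)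
  next
    fix a assume a: "a \<in> int_tuples n" and w: "weight n a < p"
    interpret X: left_module R "X a k" using a by (rule left_module_X)
    show "(b \<oplus>\<^bsub>T k\<^esub> c) a = b a"
      unfolding T_add_apply[OF a] c_low[OF a w] using T_component_closed[OF b a] by (rule X.M.r_zero)
  next
    fix a assume a: "a \<in> int_tuples n" and w: "weight n a < p + 1"
    interpret X: left_module R "X a (k + 1)" using a by (rule left_module_X)
    have "D k (b \<oplus>\<^bsub>T k\<^esub> c) a = D k b a \<oplus>\<^bsub>X a (k + 1)\<^esub> (z a \<ominus>\<^bsub>X a (k + 1)\<^esub> D k b a)"
      using a w by (simp add: module_homsD(2)[OF D_hom b c(1)] T_add_apply Dc T_minus_apply[OF z Db])
    also have "\<dots> = z a"
      using T_component_closed[OF z a] T_component_closed[OF Db a]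
      by (simp add: X.M.minus_eq X.M.a_lcomm X.M.r_neg)
    finally show "D k (b \<oplus>\<^bsub>T k\<^esub> c) a = z a" .
  qed
qed

section \<open>Gluing the successive corrections into a primitive\<close>

lemma cocycle_imp_coboundary:
  assumes z: "z \<in> carrier (T (k + 1))" and Dz: "D (k + 1) z = \<zero>\<^bsub>T (k + 2)\<^esub>"
  shows "z \<in> D k ` carrier (T k)"
proof -
  interpret T0: left_module R "T k" by (rule left_module_T)
  obtain l where l: "supp_ge l (k + 1) z"
    using z unfolding carrier_T_iff by blast
  \<comment> \<open>Tuples with all coordinates at least \<open>l\<close> have weight at least
    \<open>?p\<close>, so \<open>z\<close> vanishes below \<open>?p\<close> and the zero cochain is
    a valid start.\<close>
  let ?p = "int n * l"
  let ?P = "\<lambda>m b. b \<in> carrier (T k) \<and> supp_ge l k b \<and>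
    (\<forall>a\<in>int_tuples n. weight n a < ?p + int m \<longrightarrow> D k b a = z a)"
  \<comment> \<open>The choice must also record that each stage preserves the components already
    settled; \<open>?P\<close> alone would not make the sequence stabilise.\<close>
  let ?Q = "\<lambda>m b b'. \<forall>a\<in>int_tuples n. weight n a < ?p + int m \<longrightarrow> b' a = b a"
  have init: "?P 0 \<zero>\<^bsub>T k\<^esub>"
  proof (intro conjI ballI impI)
    show "supp_ge l k \<zero>\<^bsub>T k\<^esub>" by (simp add: supp_ge_def T_zero_apply)
    fix a assume a: "a \<in> int_tuples n" and w: "weight n a < ?p + int 0"
    have "\<not> (\<forall>i\<in>{1..n}. l \<le> a i)"
      using sum_bounded_below[of "{1..n}" l a] w by force
    then have "z a = \<zero>\<^bsub>X a (k + 1)\<^esub>"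
      using l a unfolding supp_ge_def by blast
    moreover have "D k \<zero>\<^bsub>T k\<^esub> = \<zero>\<^bsub>T (k + 1)\<^esub>"
      by (rule module_homs_zero[OF D_hom left_module_T left_module_T])
    ultimately show "D k \<zero>\<^bsub>T k\<^esub> a = z a" using a by (simp add: T_zero_apply)
  qed simp
  have step: "\<exists>b'. ?P (Suc m) b' \<and> ?Q m b b'" if P: "?P m b" for b m
  proof -
    obtain b' where "b' \<in> carrier (T k)" "supp_ge l k b'"
      "\<And>a. \<lbrakk>a \<in> int_tuples n; weight n a < ?p + int m\<rbrakk> \<Longrightarrow> b' a = b a"
      "\<And>a. \<lbrakk>a \<in> int_tuples n; weight n a < ?p + int m + 1\<rbrakk> \<Longrightarrow> D k b' a = z a"
      using improve_primitive[OF z Dz l, of b "?p + int m"] P by metis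
    then show ?thesis by (intro exI[of _ b']) (simp add: algebra_simps)
  qed
  have "\<exists>b. \<forall>m. ?P m (b m) \<and> ?Q m (b m) (b (Suc m))"
    by (rule dependent_nat_choice) (rule exI, rule init, rule step)
  then obtain b where P: "\<And>m. ?P m (b m)" and Q: "\<And>m. ?Q m (b m) (b (Suc m))"
    by blast
  have stable: "b m' a = b m a"
    if "m \<le> m'" "a \<in> int_tuples n" "weight n a < ?p + int m" for m m' a
    using that(1)
  proof (induction m' rule: dec_induct)
    case (step i)
    then show ?case using Q[of i] that(2,3) by auto
  qed simp
  \<comment> \<open>A stage at which the component at \<open>a\<close> is final: \<open>nat\<close>
    sends weights below \<open>?p\<close> to 0, and the added 1 makes the inequality in
    \<open>h\<close> strict.\<close>
  define h where "h a = nat (weight n a - ?p) + 1" for a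
  have h: "weight n a < ?p + int (h a)" for a
    by (simp add: h_def)
  \<comment> \<open>The pointwise limit of the stages. It satisfies the truncation condition because
    every \<open>b m\<close> has the same bound \<open>l\<close>.\<close>
  define \<beta> where "\<beta> = (\<lambda>a\<in>int_tuples n. b (h a) a)"
  have \<beta>_eq: "\<beta> a = b m a" if "a \<in> int_tuples n" "weight n a < ?p + int m" for a m
    using stable[of m "h a" a] stable[of "h a" m a] that h[of a] by (cases "m \<le> h a") (auto simp: \<beta>_def)
  have "supp_ge l k \<beta>"
    using P unfolding supp_ge_def \<beta>_def by simp
  moreover have "\<beta> a \<in> carrier (X a k)" if "a \<in> int_tuples n" for a
    using P T_component_closed that by (simp add: \<beta>_def)
  ultimately have \<beta>: "\<beta> \<in> carrier (T k)"
    unfolding carrier_T_iff by (auto simp: \<beta>_def)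
  have "D k \<beta> a = z a" if a: "a \<in> int_tuples n" for a
  proof -
    \<comment> \<open>The predecessors of \<open>a\<close> have smaller weight, so
      \<open>\<beta>\<close> agrees with the single stage \<open>b (h a)\<close> at \<open>a\<close>
      and at all of them.\<close>
    have "D k \<beta> a = D k (b (h a)) a"
    proof (rule D_local)
      fix i assume i: "i \<in> {1..n}"
      show "\<beta> (a(i := a i - 1)) = b (h a) (a(i := a i - 1))"
        using a i h[of a] weight_fun_upd_minus_one[OF i, of a] by (intro \<beta>_eq) simp_all
    qed (use \<beta> P a \<beta>_eq[OF a h] in auto)
    then show ?thesis using P h a by simp
  qed
  then have "D k \<beta> = z"
    using D_closed[OF \<beta>] z by (intro T_eqI)
  then show ?thesis using \<beta> by blast
qed

lemma acyclic_trTot: "acyclic_complex T D"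
  unfolding acyclic_complex_def
proof
  fix k :: int
  \<comment> \<open>The preceding lemma starts from degree \<open>k\<close> and treats cocycles of
    degree \<open>k + 1\<close>, so the degree is shifted by one.\<close>
  define j where "j = k - 1"
  then have k: "k = j + 1" by simp
  have "a_kernel (T (j + 1)) (T (j + 2)) (D (j + 1)) = D j ` carrier (T j)"
    using cocycle_imp_coboundary D_closed D_D by (auto simp: a_kernel_def')
  then show "a_kernel (T k) (T (k + 1)) (D k) = D (k - 1) ` carrier (T (k - 1))"
    by (simp add: k add.assoc)
qed

end

theorem mainTheorem6:
  fixes R :: "('r, 'x) ring_scheme"
    and n :: nat
    and E :: "(nat \<Rightarrow> int) \<Rightarrow> ('r, 'm, 'y) module_scheme"
    and d :: "nat \<Rightarrow> (nat \<Rightarrow> int) \<Rightarrow> 'm \<Rightarrow> 'm"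
  assumes "ring R"
    and "multicomplex R (n + 1) E d"
    and "\<And>a. a \<in> int_tuples n \<Longrightarrow>
      acyclic_complex (\<lambda>m. E (a(n + 1 := m))) (\<lambda>m. d (n + 1) (a(n + 1 := m)))"
  shows "acyclic_complex (trTot n E) (trTot_diff n E d)"
proof -
  interpret exact_total_multicomplex R n E d
    using assms
    by (intro exact_total_multicomplex.intro total_multicomplex.intro
        exact_total_multicomplex_axioms.intro)
  show ?thesis by (rule acyclic_trTot)
qed

end
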